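(* Let $\mathcal H=\mathcal H_0\oplus\mathcal H_1$, $A$, $W$, $V$, $X$, $Y$, $T$ be as in the context. Then the operator $A+V$ admits the block diagonalization (as an equality of operators, including domains) $$T^*(A+V)(T^* )^{-1}=A-YV=\begin{pmatrix}A_0+X^*W^*&0\\0&A_1-XW\end{pmatrix}$$ if and only if both of the following hold: (i) the graph subspace $\mathcal G(\mathcal H_0,X)$ is reducing for $A+V$; and (ii) the operator $Y$ is a strong solution to the operator Riccati equation $AY-YA-YVY+V=0$. In this case, $A+V$ also admits the block diagonalization (again as an equality of operators) $$T^{-1}(A+V)T=A+VY=\begin{pmatrix}A_0+WX&0\\0&A_1-W^*X^*\end{pmatrix}.$$
   Context: Hilbert spaces are complex. Setting: $\mathcal H=\mathcal H_0\oplus\mathcal H_1$ is a Hilbert space decomposed into two orthogonal subspaces. $A=\begin{pmatrix}A_0&0\\0&A_1\end{pmatrix}$ with $\mathrm{Dom}(A)=\mathrm{Dom}(A_0)\oplus\mathrm{Dom}(A_1)$ is a (possibly unbounded) self-adjoint operator on $\mathcal H$. $W\colon\mathcal H_1\supset\mathrm{Dom}(W)\to\mathcal H_0$ is a densely defined linear operator with $\mathrm{Dom}(W)\supset\mathrm{Dom}(A_1)$ and $\mathrm{Dom}(W^* )\supset\mathrm{Dom}(A_0)$, and $V=\begin{pmatrix}0&W\\ W^*&0\end{pmatrix}$ on $\mathrm{Dom}(V)=\mathrm{Dom}(W^* )\oplus\mathrm{Dom}(W)\supset\mathrm{Dom}(A)$. $X\colon\mathcal H_0\to\mathcal H_1$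 is a bounded linear operator, and $$Y=\begin{pmatrix}0&-X^*\\ X&0\end{pmatrix},\qquad T=I_{\mathcal H}+Y=\begin{pmatrix}I_{\mathcal H_0}&-X^*\\ X&I_{\mathcal H_1}\end{pmatrix}$$ are bounded operators on $\mathcal H$. Since $Y^*=-Y$, one has $T^*=I_{\mathcal H}-Y$, and $T$, $T^*$ are boundedly invertible. Conventions on unbounded operators: sums and products have their natural domains, $\mathrm{Dom}(K+L)=\mathrm{Dom}(K)\cap\mathrm{Dom}(L)$ and $\mathrm{Dom}(KL)=\{x\in\mathrm{Dom}(L):Lx\in\mathrm{Dom}(K)\}$. In particular $\mathrm{Dom}(A+V)=\mathrm{Dom}(A)=\mathrm{Dom}(A-YV)$ and $\mathrm{Dom}(A+VY)=\{x\in\mathrm{Dom}(A):Yx\in\mathrm{Dom}(V)\}$; the entries of block diagonal matrices likewise have natural domains. $K\subset L$ means $\mathrm{Dom}(K)\subset\mathrm{Dom}(L)$ and $Kx=Lx$ on $\mathrm{Dom}(K)$; $K=L$ means $K\subset L$ and $L\subset K$. Graph subspaces: $\mathcal G(\mathcal H_0,X)=\{f\oplus Xf:f\in\mathcal H_0\}$, a closed subspace with orthogonal complement $\mathcal G(\mathcal H_1,-X^* )=\{-X^*g\oplus g:g\in\mathcal H_1\}$. A closed subspace $\mathcal G\subset\mathcal H$ is invariant for a linear operator $B$ if $Bx\in\mathcal G$ for all $x\in\mathrm{Dom}(B)\cap\mathcal G$. It is reducing for $B$ if $\mathcal G$ and $\mathcal G^\perp$ are both invariant for $B$ and $\mathrm{Dom}(B)=(\mathrm{Dom}(B)\cap\mathcal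 G)+(\mathrm{Dom}(B)\cap\mathcal G^\perp)$. $Y$ is a strong solution to the operator Riccati equation $AY-YA-YVY+V=0$ if $Yx\in\mathrm{Dom}(A)$ and $AYx-YAx-YVYx+Vx=0$ for all $x\in\mathrm{Dom}(A)$. *)

theory Defs
  imports "HOL-Analysis.Analysis"
begin

class complex_vector = real_vector +
  fixes scaleC :: "complex \<Rightarrow> 'a \<Rightarrow> 'a"  (infixr \<open>*\<^sub>C\<close> 75)
  assumes scaleC_add_right: "a *\<^sub>C (x + y) = a *\<^sub>C x + a *\<^sub>C y"
    and scaleC_add_left: "(a + b) *\<^sub>C x = a *\<^sub>C x + b *\<^sub>C x"
    and scaleC_scaleC: "a *\<^sub>C (b *\<^sub>C x) = (a * b) *\<^sub>C x"
    and scaleR_scaleC: "r *\<^sub>R x = complex_of_real r *\<^sub>C x"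

class complex_inner = complex_vector + real_normed_vector +
  fixes cinner :: "'a \<Rightarrow> 'a \<Rightarrow> complex"
  assumes cinner_commute: "cinner x y = cnj (cinner y x)"
    and cinner_add_right: "cinner x (y + z) = cinner x y + cinner x z"
    and cinner_scaleC_right: "cinner x (c *\<^sub>C y) = c * cinner x y"
    and cinner_self: "cinner x x = complex_of_real ((norm x)\<^sup>2)"

class complex_hilbert = complex_inner + complete_space

interpretation complex_vector: vector_space "scaleC :: complex \<Rightarrow> 'a \<Rightarrow> 'a::complex_vector"
proof
  show "1 *\<^sub>C x = x" for x :: 'a
    using scaleR_scaleC[of 1 x] by simp
qed (simp_all add: scaleC_add_right scaleC_add_left scaleC_scaleC)

instantiation complex :: complex_hilbert
begin

definition scaleC_complex :: "complex \<Rightarrow> complex \<Rightarrow> complex" where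
  "scaleC_complex c x = c * x"

definition cinner_complex :: "complex \<Rightarrow> complex \<Rightarrow> complex" where
  "cinner_complex x y = cnj x * y"

instance
proof
  show "cinner x x = complex_of_real ((norm x)\<^sup>2)" for x :: complex
    by (simp add: cinner_complex_def complex_norm_square mult.commute del: of_real_power)
qed (simp_all add: scaleC_complex_def cinner_complex_def algebra_simps scaleR_conv_of_real)

end

text \<open>The type \<open>'a \<times> 'b\<close> plays the role of the orthogonal direct sum.\<close>

instantiation prod :: (complex_vector, complex_vector) complex_vector
begin

definition scaleC_prod :: "complex \<Rightarrow> 'a \<times> 'b \<Rightarrow> 'a \<times> 'b" where
  "scaleC_prod c x = (c *\<^sub>C fst x, c *\<^sub>C snd x)"

instance
  by standard (simp_all add: scaleC_prod_def prod_eq_iff scaleC_add_right scaleC_add_left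
      scaleC_scaleC scaleR_scaleC)

end

instantiation prod :: (complex_inner, complex_inner) complex_inner
begin

definition cinner_prod :: "'a \<times> 'b \<Rightarrow> 'a \<times> 'b \<Rightarrow> complex" where
  "cinner_prod x y = cinner (fst x) (fst y) + cinner (snd x) (snd y)"

instance
proof
  fix x y z :: "'a \<times> 'b" and c :: complex
  show "cinner x y = cnj (cinner y x)"
    unfolding cinner_prod_def complex_cnj_add
    by (simp flip: cinner_commute)
  show "cinner x (y + z) = cinner x y + cinner x z"
    by (simp add: cinner_prod_def cinner_add_right)
  show "cinner x (c *\<^sub>C y) = c * cinner x y"
    by (simp add: cinner_prod_def scaleC_prod_def cinner_scaleC_right distrib_left)
  show "cinner x x = complex_of_real ((norm x)\<^sup>2)"
    by (simp add: cinner_prod_def cinner_self norm_prod_def)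
qed

end

instance prod :: (complex_hilbert, complex_hilbert) complex_hilbert ..

definition orth_compl :: "'a::complex_inner set \<Rightarrow> 'a set" where
  "orth_compl G = {y. \<forall>x\<in>G. cinner x y = 0}"

text \<open>
  An operator is a partial map \<open>'a \<rightharpoonup> 'b\<close>. Then \<open>dom K\<close> is its domain, the composition
  \<open>K \<circ>\<^sub>m L\<close> has the natural domain \<open>{x \<in> dom L. Lx \<in> dom K}\<close>, the relation \<open>K \<subseteq>\<^sub>m L\<close>
  is operator extension, and HOL equality is equality of operators including domains.
  The value \<open>K \<cdot> x\<close> is meaningful only for \<open>x \<in> dom K\<close>.
\<close>

abbreviation op_app :: "('a \<rightharpoonup> 'b) \<Rightarrow> 'a \<Rightarrow> 'b"  (infixl \<open>\<cdot>\<close> 90) where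
  "K \<cdot> x \<equiv> the (K x)"

definition linear_op :: "('a::complex_vector \<rightharpoonup> 'b::complex_vector) \<Rightarrow> bool" where
  "linear_op K \<longleftrightarrow> complex_vector.subspace (dom K) \<and>
    (\<forall>x\<in>dom K. \<forall>y\<in>dom K. K \<cdot> (x + y) = K \<cdot> x + K \<cdot> y) \<and>
    (\<forall>c. \<forall>x\<in>dom K. K \<cdot> (c *\<^sub>C x) = c *\<^sub>C (K \<cdot> x))"

definition densely_defined :: "('a::topological_space \<rightharpoonup> 'b) \<Rightarrow> bool" where
  "densely_defined K \<longleftrightarrow> closure (dom K) = UNIV"

definition bounded_op :: "('a::complex_inner \<rightharpoonup> 'b::complex_inner) \<Rightarrow> bool" where
  "bounded_op K \<longleftrightarrow> linear_op K \<and> dom K = UNIV \<and> (\<exists>C. \<forall>x. norm (K \<cdot> x) \<le> C * norm x)"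

definition op_id :: "'a \<rightharpoonup> 'a" where
  "op_id = Some"

definition op_zero :: "'a \<rightharpoonup> 'b::zero" where
  "op_zero = (\<lambda>x. Some 0)"

definition op_add :: "('a \<rightharpoonup> 'b) \<Rightarrow> ('a \<rightharpoonup> 'b) \<Rightarrow> 'a \<rightharpoonup> 'b::plus"  (infixl \<open>+\<^sub>o\<^sub>p\<close> 52) where
  "K +\<^sub>o\<^sub>p L = (\<lambda>x. if x \<in> dom K \<inter> dom L then Some (K \<cdot> x + L \<cdot> x) else None)"

definition op_diff :: "('a \<rightharpoonup> 'b) \<Rightarrow> ('a \<rightharpoonup> 'b) \<Rightarrow> 'a \<rightharpoonup> 'b::minus"  (infixl \<open>-\<^sub>o\<^sub>p\<close> 52) where
  "K -\<^sub>o\<^sub>p L = (\<lambda>x. if x \<in> dom K \<inter> dom L then Some (K \<cdot> x - L \<cdot> x) else None)"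

definition op_uminus :: "('a \<rightharpoonup> 'b) \<Rightarrow> 'a \<rightharpoonup> 'b::uminus" where
  "op_uminus K = map_option uminus \<circ> K"

text \<open>The domain is \<open>ran K\<close>; meaningful for injective \<open>K\<close>.\<close>

definition op_inverse :: "('a \<rightharpoonup> 'b) \<Rightarrow> 'b \<rightharpoonup> 'a" where
  "op_inverse K = (\<lambda>y. if y \<in> ran K then Some (THE x. K x = Some y) else None)"

text \<open>Meaningful for densely defined \<open>K\<close>, for which \<open>z\<close> is uniquely determined by \<open>y\<close>.\<close>

definition op_adjoint :: "('a::complex_inner \<rightharpoonup> 'b::complex_inner) \<Rightarrow> 'b \<rightharpoonup> 'a"
    (\<open>_\<^sup>\<star>\<close> [1000] 999) where
  "K\<^sup>\<star> = (\<lambda>y. if \<exists>z. \<forall>x\<in>dom K. cinner y (K \<cdot> x) = cinner z x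
    then Some (THE z. \<forall>x\<in>dom K. cinner y (K \<cdot> x) = cinner z x) else None)"

definition self_adjoint :: "('a::complex_inner \<rightharpoonup> 'a) \<Rightarrow> bool" where
  "self_adjoint K \<longleftrightarrow> linear_op K \<and> densely_defined K \<and> K\<^sup>\<star> = K"

text \<open>The block operator matrix with rows \<open>(P, Q)\<close> and \<open>(R, S)\<close> on its natural domain.\<close>

definition op_block :: "('a \<rightharpoonup> 'c::plus) \<Rightarrow> ('b \<rightharpoonup> 'c) \<Rightarrow> ('a \<rightharpoonup> 'd::plus) \<Rightarrow> ('b \<rightharpoonup> 'd)
    \<Rightarrow> 'a \<times> 'b \<rightharpoonup> 'c \<times> 'd" where
  "op_block P Q R S = (\<lambda>(x, y). if x \<in> dom P \<inter> dom R \<and> y \<in> dom Q \<inter> dom S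
    then Some (P \<cdot> x + Q \<cdot> y, R \<cdot> x + S \<cdot> y) else None)"

definition op_graph :: "('a \<rightharpoonup> 'b) \<Rightarrow> ('a \<times> 'b) set" where
  "op_graph K = {(f, K \<cdot> f) | f. f \<in> dom K}"

definition invariant_subspace :: "'a::complex_inner set \<Rightarrow> ('a \<rightharpoonup> 'a) \<Rightarrow> bool" where
  "invariant_subspace G B \<longleftrightarrow> closed G \<and> complex_vector.subspace G \<and>
    (\<forall>x \<in> dom B \<inter> G. B \<cdot> x \<in> G)"

definition reducing_subspace :: "'a::complex_inner set \<Rightarrow> ('a \<rightharpoonup> 'a) \<Rightarrow> bool" where
  "reducing_subspace G B \<longleftrightarrow> invariant_subspace G B \<and> invariant_subspace (orth_compl G) B \<and>
    dom B = {x + y | x y. x \<in> dom B \<inter> G \<and> y \<in> dom B \<inter> orth_compl G}"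

text \<open>
  The equation \<open>AY - YA - YVY + V = 0\<close>. All terms are defined on \<open>dom A\<close> if \<open>Y\<close> is defined
  everywhere and \<open>dom A \<subseteq> dom V\<close>.
\<close>

definition strong_riccati_solution ::
    "('a::complex_inner \<rightharpoonup> 'a) \<Rightarrow> ('a \<rightharpoonup> 'a) \<Rightarrow> ('a \<rightharpoonup> 'a) \<Rightarrow> bool" where
  "strong_riccati_solution A V Y \<longleftrightarrow> (\<forall>x\<in>dom A. Y \<cdot> x \<in> dom A \<and>
    A \<cdot> (Y \<cdot> x) - Y \<cdot> (A \<cdot> x) - Y \<cdot> (V \<cdot> (Y \<cdot> x)) + V \<cdot> x = 0)"

end

theory Submission imports Defs begin

text \<open>
  Since \<open>Y\<close> is skew, \<open>T\<close> and \<open>T\<^sup>\<star> = I - Y\<close> are injective, and \<open>T\<^sup>\<star>\<close> maps the graph subspace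
  into the first summand and its orthogonal complement into the second. On \<open>dom A\<close> the Riccati
  equation is a rewriting of \<open>T\<^sup>\<star>(A + V) = (A - YV)T\<^sup>\<star>\<close>, and equally of \<open>(A + V)T = T(A + VY)\<close>.
  What remains concerns domains: splitting \<open>(u, 0)\<close> and \<open>(0, v)\<close> in \<open>dom A\<close> along the graph and
  its complement exhibits their preimages under \<open>T\<^sup>\<star>\<close> in \<open>dom A\<close>, and conversely the preimages of
  \<open>(u, 0)\<close> and \<open>(0, v)\<close> provide the splitting of \<open>dom A\<close>. Surjectivity of \<open>T\<^sup>\<star>\<close> is never needed.
\<close>

section \<open>Complex inner products\<close>

lemma scaleC_minus_one: "(- 1) *\<^sub>C x = - (x :: 'a::complex_vector)"
  by (metis complex_vector.scale_minus_left complex_vector.scale_one)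

lemma cinner_add_left: "cinner (x + y) z = cinner x z + cinner (y :: 'a::complex_inner) z"
  by (metis cinner_add_right cinner_commute complex_cnj_add)

lemma cinner_scaleC_left: "cinner (c *\<^sub>C x) z = cnj c * cinner x (z :: 'a::complex_inner)"
  by (metis cinner_commute cinner_scaleC_right complex_cnj_mult)

lemma cinner_minus_right: "cinner z (- x) = - cinner z (x :: 'a::complex_inner)"
  using cinner_scaleC_right[of z "- 1" x] by (simp add: scaleC_minus_one)

lemma cinner_minus_left: "cinner (- x) z = - cinner x (z :: 'a::complex_inner)"
  using cinner_scaleC_left[of "- 1" x z] by (simp add: scaleC_minus_one)

lemma cinner_diff_right: "cinner z (x - y) = cinner z x - cinner z (y :: 'a::complex_inner)"
  using cinner_add_right[of z x "- y"] by (simp add: cinner_minus_right)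

lemma cinner_diff_left: "cinner (x - y) z = cinner x z - cinner (y :: 'a::complex_inner) z"
  using cinner_add_left[of x "- y" z] by (simp add: cinner_minus_left)

lemma cinner_zero_right [simp]: "cinner z (0 :: 'a::complex_inner) = 0"
  using cinner_diff_right[of z 0 0] by simp

lemma cinner_zero_left [simp]: "cinner (0 :: 'a::complex_inner) z = 0"
  using cinner_diff_left[of 0 0 z] by simp

lemma cinner_eq_zero_iff [simp]: "cinner x x = 0 \<longleftrightarrow> x = (0 :: 'a::complex_inner)"
  by (simp add: cinner_self)

lemma norm_sq_eq_Re_cinner: "(norm x)\<^sup>2 = Re (cinner x (x :: 'a::complex_inner))"
  by (simp add: cinner_self)

text \<open>Pythagoras for the component of \<open>y\<close> orthogonal to \<open>x\<close>. It
  serves twice: the left side is nonnegative, which gives Cauchy-Schwarz, and it measures how much a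
  vector shortens, which drives the minimality argument for Riesz.\<close>

lemma norm_sq_diff_projection:
  fixes x y :: "'a::complex_inner"
  assumes "x \<noteq> 0"
  shows "(norm (y - (cinner x y / (norm x)\<^sup>2) *\<^sub>C x))\<^sup>2
    = (norm y)\<^sup>2 - (cmod (cinner x y))\<^sup>2 / (norm x)\<^sup>2"
proof -
  define a where "a = cinner x y"
  define c where "c = a / complex_of_real ((norm x)\<^sup>2)"
  have yx: "cinner y x = cnj a" unfolding a_def by (rule cinner_commute)
  \<comment> \<open>In the expansion below, this turns the quadratic term into
    \<open>cnj c * a\<close>, which cancels one of the two cross terms.\<close>
  have xx: "c * complex_of_real ((norm x)\<^sup>2) = a"
    using assms by (simp add: c_def)
  have "cinner (y - c *\<^sub>C x) (y - c *\<^sub>C x)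
      = cinner y y - c * cnj a - cnj c * a + cnj c * (c * complex_of_real ((norm x)\<^sup>2))"
    by (simp add: cinner_diff_left cinner_diff_right cinner_scaleC_left cinner_scaleC_right yx
        cinner_self[of x] algebra_simps flip: a_def)
  also have "\<dots> = cinner y y - c * cnj a"
    by (simp only: xx) simp
  also have "c * cnj a = complex_of_real ((cmod a)\<^sup>2 / (norm x)\<^sup>2)"
    unfolding c_def by (simp add: complex_norm_square del: of_real_power)
  finally have "cinner (y - c *\<^sub>C x) (y - c *\<^sub>C x)
      = complex_of_real ((norm y)\<^sup>2 - (cmod a)\<^sup>2 / (norm x)\<^sup>2)"
    by (simp add: cinner_self)
  then show ?thesis
    unfolding norm_sq_eq_Re_cinner[of "y - _"] c_def a_def by simp
qed

lemma cinner_Cauchy_Schwarz: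
  fixes x y :: "'a::complex_inner"
  shows "cmod (cinner x y) \<le> norm x * norm y"
proof (cases "x = 0")
  case False
  have "0 \<le> (norm y)\<^sup>2 - (cmod (cinner x y))\<^sup>2 / (norm x)\<^sup>2"
    unfolding norm_sq_diff_projection[OF False, symmetric] by simp
  then have "(cmod (cinner x y))\<^sup>2 \<le> (norm x * norm y)\<^sup>2"
    using False by (simp add: field_simps power_mult_distrib)
  then show ?thesis
    by (rule power2_le_imp_le) simp
qed simp

lemma bounded_linear_cinner_right: "bounded_linear (cinner (x :: 'a::complex_inner))"
proof (rule bounded_linear_intro)
  show "cinner x (r *\<^sub>R y) = r *\<^sub>R cinner x y" for r y
    by (simp add: scaleR_scaleC[of r y] cinner_scaleC_right scaleR_conv_of_real)
  show "cmod (cinner x y) \<le> norm y * norm x" for y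
    using cinner_Cauchy_Schwarz[of x y] by (simp add: mult.commute)
qed (rule cinner_add_right)

lemma parallelogram_law:
  fixes x y :: "'a::complex_inner"
  shows "(norm (x - y))\<^sup>2 + (norm (x + y))\<^sup>2 = 2 * (norm x)\<^sup>2 + 2 * (norm y)\<^sup>2"
  by (simp add: norm_sq_eq_Re_cinner cinner_add_left cinner_add_right cinner_diff_left
      cinner_diff_right)

text \<open>The vectors annihilated by \<open>z - w\<close> form a closed set; if it contains a
  dense set, it contains \<open>z - w\<close> itself. This is the uniqueness behind the
  \<open>THE\<close> in the adjoint.\<close>

lemma eq_if_cinner_eq_on_dense:
  fixes z w :: "'a::complex_inner"
  assumes "closure D = UNIV" and "\<And>x. x \<in> D \<Longrightarrow> cinner z x = cinner w x"
  shows "z = w"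
proof -
  have "closed {x. cinner (z - w) x = 0}"
    by (intro closed_Collect_eq continuous_on_const
        linear_continuous_on bounded_linear_cinner_right)
  moreover have "D \<subseteq> {x. cinner (z - w) x = 0}"
    using assms(2) by (auto simp: cinner_diff_left)
  ultimately have "closure D \<subseteq> {x. cinner (z - w) x = 0}"
    by (rule closure_minimal[rotated])
  then have "cinner (z - w) (z - w) = 0"
    using assms(1) by blast
  then show ?thesis by simp
qed

lemma closed_orth_compl: "closed (orth_compl G)"
proof -
  have "orth_compl G = (\<Inter>x\<in>G. {y. cinner x y = 0})"
    by (auto simp: orth_compl_def)
  also have "closed \<dots>"
    by (intro closed_INT ballI closed_Collect_eq continuous_on_const
        linear_continuous_on bounded_linear_cinner_right)
  finally show ?thesis .
qed

lemma subspace_orth_compl: "complex_vector.subspace (orth_compl G)"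
  by (simp add: complex_vector.subspace_def orth_compl_def cinner_add_right cinner_scaleC_right)

text \<open>The Riesz vector is a multiple of the vector of minimal norm in the hyperplane \<open>\<phi> = 1\<close>.\<close>

lemma Riesz_representation:
  fixes \<phi> :: "'a::complex_hilbert \<Rightarrow> complex"
  assumes lin: "bounded_linear \<phi>" and hom: "\<And>c x. \<phi> (c *\<^sub>C x) = c * \<phi> x"
  obtains z where "\<And>x. \<phi> x = cinner z x"
proof (cases "\<exists>x. \<phi> x \<noteq> 0")
  case False
  then show thesis using that[of 0] by simp
next
  case True
  interpret bounded_linear \<phi> by (rule lin)
  from True obtain x0 where x0: "\<phi> x0 \<noteq> 0" by blast
  define S where "S = {x. \<phi> x = 1}"
  define d where "d = Inf ((\<lambda>x. (norm x)\<^sup>2) ` S)"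
  have "(1 / \<phi> x0) *\<^sub>C x0 \<in> S" using x0 by (simp add: S_def hom)
  then have S_ne: "S \<noteq> {}" by blast
  have d_le: "d \<le> (norm x)\<^sup>2" if "x \<in> S" for x
    unfolding d_def using that by (intro cInf_lower bdd_belowI[where m = 0]) auto
  have "\<exists>x\<in>S. (norm x)\<^sup>2 < d + 1 / Suc n" for n
  proof -
    have "\<exists>r\<in>(\<lambda>x. (norm x)\<^sup>2) ` S. r < d + 1 / Suc n"
      unfolding d_def using S_ne by (intro cInf_lessD) auto
    then show ?thesis by blast
  qed
  then obtain s where s: "s n \<in> S" "(norm (s n))\<^sup>2 < d + 1 / Suc n" for n
    by metis
  \<comment> \<open>Midpoints stay in the hyperplane, so the squared norm of the sum is at least
    \<open>4 * d\<close>; in the parallelogram law this absorbs all multiples of \<open>d\<close>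
    and leaves only the errors of the minimizing sequence.\<close>
  have dist_s: "(dist (s m) (s n))\<^sup>2 \<le> 2 / Suc m + 2 / Suc n" for m n
  proof -
    have "(1/2) *\<^sub>R (s m + s n) \<in> S"
      using s(1)[of m] s(1)[of n] by (simp add: S_def add scaleR scaleR_conv_of_real)
    from d_le[OF this] have "4 * d \<le> (norm (s m + s n))\<^sup>2"
      by (simp add: power_divide)
    with parallelogram_law[of "s m" "s n"] s(2)[of m] s(2)[of n]
    show ?thesis by (simp add: dist_norm)
  qed
  have "Cauchy s"
  proof (rule metric_CauchyI)
    fix e :: real assume "e > 0"
    then have "4 / e\<^sup>2 > 0" by simp
    then obtain N where N: "4 / e\<^sup>2 < real (Suc N)"
      by (meson reals_Archimedean2 less_trans of_nat_less_iff lessI)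
    have "dist (s m) (s n) < e" if "m \<ge> N" "n \<ge> N" for m n
    proof -
      have "(dist (s m) (s n))\<^sup>2 \<le> 2 / Suc N + 2 / Suc N"
        using that by (intro order.trans[OF dist_s] add_mono divide_left_mono) auto
      also have "\<dots> = 4 / Suc N" by simp
      also have "\<dots> < e\<^sup>2"
        using N \<open>e > 0\<close> by (simp add: divide_less_eq mult.commute del: of_nat_Suc)
      finally show ?thesis using \<open>e > 0\<close> by (meson less_le power2_less_imp_less)
    qed
    then show "\<exists>M. \<forall>m\<ge>M. \<forall>n\<ge>M. dist (s m) (s n) < e" by blast
  qed
  then obtain m where m: "s \<longlonglongrightarrow> m"
    using Cauchy_convergent convergent_def by blast
  have "(\<lambda>n. \<phi> (s n)) \<longlonglongrightarrow> \<phi> m" by (rule tendsto[OF m])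
  moreover have "\<phi> (s n) = 1" for n using s(1) by (simp add: S_def)
  ultimately have phi_m: "\<phi> m = 1" by (simp add: LIMSEQ_const_iff)
  have norm_m: "(norm m)\<^sup>2 \<le> d"
  proof (rule LIMSEQ_le)
    show "(\<lambda>n. (norm (s n))\<^sup>2) \<longlonglongrightarrow> (norm m)\<^sup>2" by (intro tendsto_intros m)
    show "(\<lambda>n. d + 1 / real (Suc n)) \<longlonglongrightarrow> d"
      using LIMSEQ_Suc[OF lim_1_over_n[where 'a = real]] tendsto_add[OF tendsto_const[of d]]
      by fastforce
    show "\<exists>N. \<forall>n\<ge>N. (norm (s n))\<^sup>2 \<le> d + 1 / real (Suc n)"
      using s(2) by (auto intro: less_imp_le)
  qed
  \<comment> \<open>Removing from \<open>m\<close> its projection onto a kernel vector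
    \<open>k\<close> does not leave the hyperplane, and would push the squared norm below
    \<open>d\<close> unless the projection vanishes.\<close>
  have ker: "cinner m k = 0" if "\<phi> k = 0" for k
  proof (cases "k = 0")
    case False
    let ?w = "m - (cinner k m / (norm k)\<^sup>2) *\<^sub>C k"
    have "\<phi> ?w = 1" using that phi_m by (simp add: diff hom)
    then have "d \<le> (norm ?w)\<^sup>2" by (intro d_le) (simp add: S_def)
    with norm_m norm_sq_diff_projection[OF False, of m]
    have "(cmod (cinner k m))\<^sup>2 / (norm k)\<^sup>2 \<le> 0" by linarith
    then have "cinner k m = 0"
      using False by (simp add: divide_le_0_iff)
    then show ?thesis using cinner_commute[of m k] by simp
  qed simp
  have "m \<noteq> 0" using phi_m zero by auto
  show thesis
  proof (rule that)
    fix x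
    \<comment> \<open>Since \<phi> is 1 at \<open>m\<close>, subtracting
      \<open>\<phi> x *\<^sub>C m\<close> projects \<open>x\<close> into the kernel. Dividing by the
      squared norm of \<open>m\<close> then normalizes the representing vector.\<close>
    have "cinner m (x - \<phi> x *\<^sub>C m) = 0"
      by (rule ker) (simp add: diff hom phi_m)
    then have "cinner m x = \<phi> x * complex_of_real ((norm m)\<^sup>2)"
      by (simp add: cinner_diff_right cinner_scaleC_right cinner_self)
    then show "\<phi> x = cinner ((1 / complex_of_real ((norm m)\<^sup>2)) *\<^sub>C m) x"
      using \<open>m \<noteq> 0\<close> by (simp add: cinner_scaleC_left)
  qed
qed

section \<open>Adjoints and linear operators\<close>

text \<open>Density makes the witness \<open>z\<close> unique, so exhibiting one suffices to
  evaluate the adjoint, domain membership included.\<close>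

lemma op_adjoint_eqI:
  assumes "densely_defined K" and "\<And>x. x \<in> dom K \<Longrightarrow> cinner y (K \<cdot> x) = cinner z x"
  shows "(K\<^sup>\<star>) y = Some z"
proof -
  have "(THE z. \<forall>x\<in>dom K. cinner y (K \<cdot> x) = cinner z x) = z"
  proof (rule the_equality)
    show "\<forall>x\<in>dom K. cinner y (K \<cdot> x) = cinner z x" using assms(2) by blast
    show "w = z" if "\<forall>x\<in>dom K. cinner y (K \<cdot> x) = cinner w x" for w
      using that assms by (intro eq_if_cinner_eq_on_dense[of "dom K"])
        (auto simp: densely_defined_def)
  qed
  then show ?thesis
    using assms(2) unfolding op_adjoint_def by auto
qed

lemma op_adjoint_cinner:
  assumes "densely_defined K" and "y \<in> dom (K\<^sup>\<star>)" and "x \<in> dom K"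
  shows "cinner y (K \<cdot> x) = cinner (K\<^sup>\<star> \<cdot> y) x"
proof -
  have "\<exists>z. \<forall>x\<in>dom K. cinner y (K \<cdot> x) = cinner z x"
    using assms(2) by (metis domIff op_adjoint_def)
  then obtain z where z: "\<forall>x\<in>dom K. cinner y (K \<cdot> x) = cinner z x" ..
  then have "(K\<^sup>\<star>) y = Some z" using assms(1) by (intro op_adjoint_eqI) auto
  then show ?thesis using z assms(3) by simp
qed

lemma linear_op_adjoint:
  assumes "densely_defined K"
  shows "linear_op (K\<^sup>\<star>)"
proof -
  have 0: "(K\<^sup>\<star>) 0 = Some 0"
    by (rule op_adjoint_eqI[OF assms]) simp
  have add: "(K\<^sup>\<star>) (x + y) = Some (K\<^sup>\<star> \<cdot> x + K\<^sup>\<star> \<cdot> y)" if "x \<in> dom (K\<^sup>\<star>)" "y \<in> dom (K\<^sup>\<star>)" for x y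
    by (rule op_adjoint_eqI[OF assms])
      (simp only: cinner_add_left op_adjoint_cinner[OF assms] that)
  have scale: "(K\<^sup>\<star>) (c *\<^sub>C x) = Some (c *\<^sub>C (K\<^sup>\<star> \<cdot> x))" if "x \<in> dom (K\<^sup>\<star>)" for c x
    by (rule op_adjoint_eqI[OF assms])
      (simp only: cinner_scaleC_left op_adjoint_cinner[OF assms] that)
  show ?thesis
    unfolding linear_op_def complex_vector.subspace_def
    by (intro conjI ballI allI) (simp_all add: 0 add scale domI)
qed

lemma bounded_op_total: "bounded_op K \<Longrightarrow> K x = Some (K \<cdot> x)"
  by (cases "K x") (auto simp: bounded_op_def)

lemma bounded_op_densely_defined: "bounded_op K \<Longrightarrow> densely_defined K"
  by (simp add: bounded_op_def densely_defined_def)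

lemma bounded_op_bounded_linear:
  assumes "bounded_op K"
  shows "bounded_linear (\<lambda>x. K \<cdot> x)"
proof -
  have lin: "K \<cdot> (x + y) = K \<cdot> x + K \<cdot> y" "K \<cdot> (c *\<^sub>C x) = c *\<^sub>C (K \<cdot> x)" for x y c
    using assms by (auto simp: bounded_op_def linear_op_def)
  obtain C where C: "norm (K \<cdot> x) \<le> C * norm x" for x
    using assms by (auto simp: bounded_op_def)
  show ?thesis
    by (rule bounded_linear_intro[where K = C])
      (use C in \<open>simp_all add: lin scaleR_scaleC mult.commute\<close>)
qed

text \<open>By Cauchy-Schwarz, pairing \<open>K\<close> with a fixed \<open>y\<close> is a bounded
  functional, and its Riesz vector is the value of the adjoint at \<open>y\<close>. Completeness
  enters through the domain space.\<close>

lemma dom_bounded_op_adjoint: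
  fixes K :: "'a::complex_hilbert \<rightharpoonup> 'b::complex_inner"
  assumes "bounded_op K"
  shows "dom (K\<^sup>\<star>) = UNIV"
proof -
  have "(K\<^sup>\<star>) y \<noteq> None" for y
  proof -
    have "bounded_linear (\<lambda>x. cinner y (K \<cdot> x))"
      by (rule bounded_linear_compose[OF bounded_linear_cinner_right
            bounded_op_bounded_linear[OF assms]])
    moreover have "cinner y (K \<cdot> (c *\<^sub>C x)) = c * cinner y (K \<cdot> x)" for c x
      using assms by (simp add: bounded_op_def linear_op_def cinner_scaleC_right)
    ultimately obtain z where "\<And>x. cinner y (K \<cdot> x) = cinner z x"
      using Riesz_representation by blast
    then have "(K\<^sup>\<star>) y = Some z"
      by (intro op_adjoint_eqI bounded_op_densely_defined[OF assms])
    then show ?thesis by simp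
  qed
  then show ?thesis by auto
qed

lemma linear_op_zero_dom: "linear_op K \<Longrightarrow> 0 \<in> dom K"
  by (simp add: linear_op_def complex_vector.subspace_def)

lemma linear_op_add:
  assumes "linear_op K" "x \<in> dom K" "y \<in> dom K"
  shows "x + y \<in> dom K" "K \<cdot> (x + y) = K \<cdot> x + K \<cdot> y"
  using assms by (auto simp: linear_op_def complex_vector.subspace_def)

lemma linear_op_minus:
  assumes "linear_op K" "x \<in> dom K"
  shows "- x \<in> dom K" "K \<cdot> (- x) = - (K \<cdot> x)"
  using assms scaleC_minus_one[of x] scaleC_minus_one[of "K \<cdot> x"]
  unfolding linear_op_def complex_vector.subspace_def by metis+

lemma linear_op_diff:
  assumes "linear_op K" "x \<in> dom K" "y \<in> dom K"
  shows "x - y \<in> dom K" "K \<cdot> (x - y) = K \<cdot> x - K \<cdot> y"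
  using linear_op_add[OF assms(1,2) linear_op_minus(1)[OF assms(1,3)]]
    linear_op_minus[OF assms(1,3)] by simp_all

lemma linear_op_zero: "linear_op K \<Longrightarrow> K \<cdot> 0 = 0"
  using linear_op_diff(2)[of K 0 0] by (simp add: linear_op_zero_dom)

lemma linear_op_minus_dom_iff: "linear_op K \<Longrightarrow> - x \<in> dom K \<longleftrightarrow> x \<in> dom K"
  using linear_op_minus(1)[of K x] linear_op_minus(1)[of K "- x"] by auto

section \<open>Similarity of partial operators\<close>

lemma op_inverse_Some:
  assumes "inj S"
  shows "op_inverse (\<lambda>x. Some (S x)) (S x) = Some x"
  using assms by (auto simp: op_inverse_def ran_def inj_eq)

lemma dom_op_inverse_Some: "dom (op_inverse (\<lambda>x. Some (S x))) = range S"
  by (auto simp: op_inverse_def ran_def split: if_splits)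

text \<open>The composite is undefined off \<open>range S\<close>, whence the range condition on
  \<open>L\<close>. At \<open>S x\<close> it equals \<open>map_option S (K x)\<close>, so the second
  condition carries the equality of domains as well as of values.\<close>

lemma similar_eq_iff:
  assumes "inj S"
  shows "(\<lambda>x. Some (S x)) \<circ>\<^sub>m K \<circ>\<^sub>m op_inverse (\<lambda>x. Some (S x)) = L \<longleftrightarrow>
    dom L \<subseteq> range S \<and> (\<forall>x. L (S x) = map_option S (K x))"
    (is "?M = L \<longleftrightarrow> _")
proof -
  have on: "?M (S x) = map_option S (K x)" for x
    by (simp add: map_comp_def op_inverse_Some[OF assms] split: option.split)
  have off: "?M y = None" if "y \<notin> range S" for y
    using that dom_op_inverse_Some[of S] by (auto simp: map_comp_def split: option.split)
  show ?thesis
  proof (intro iffI conjI)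
    assume eq: "?M = L"
    show "dom L \<subseteq> range S"
      using off[unfolded eq] by (metis domIff subsetI)
    show "\<forall>x. L (S x) = map_option S (K x)"
      using on[unfolded eq] by simp
  next
    assume *: "dom L \<subseteq> range S \<and> (\<forall>x. L (S x) = map_option S (K x))"
    show "?M = L"
    proof
      fix y show "?M y = L y"
      proof (cases "y \<in> range S")
        case True then show ?thesis using * on by auto
      next
        case False
        with * have "L y = None" by blast
        with off[OF False] show ?thesis by simp
      qed
    qed
  qed
qed

text \<open>In this order the inverse is applied only to values that the hypothesis already places
  in \<open>range S\<close>.\<close>

lemma similar_eqI:
  assumes "inj S" and "\<And>x. K (S x) = map_option S (L x)"
  shows "op_inverse (\<lambda>x. Some (S x)) \<circ>\<^sub>m K \<circ>\<^sub>m (\<lambda>x. Some (S x)) = L"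
  by (rule ext) (simp add: map_comp_def assms(2) op_inverse_Some[OF assms(1)] split: option.split)

section \<open>Domains and values of composite operators\<close>

lemma op_eqI:
  assumes "dom K = dom L" and "\<And>x. x \<in> dom L \<Longrightarrow> K \<cdot> x = L \<cdot> x"
  shows "K = L"
proof
  fix x show "K x = L x"
    using assms by (cases "K x"; cases "L x") (force simp: dom_def)+
qed

lemma eq_map_option_iff:
  "L a = map_option S (K u) \<longleftrightarrow>
    (a \<in> dom L \<longleftrightarrow> u \<in> dom K) \<and> (u \<in> dom K \<longrightarrow> L \<cdot> a = S (K \<cdot> u))"
  by (cases "L a"; cases "K u") (auto simp: domIff)

lemma dom_op_add [simp]: "dom (K +\<^sub>o\<^sub>p L) = dom K \<inter> dom L"
  by (auto simp: op_add_def split: if_splits)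

lemma op_add_app [simp]: "x \<in> dom K \<Longrightarrow> x \<in> dom L \<Longrightarrow> (K +\<^sub>o\<^sub>p L) \<cdot> x = K \<cdot> x + L \<cdot> x"
  by (simp add: op_add_def)

lemma dom_op_diff [simp]: "dom (K -\<^sub>o\<^sub>p L) = dom K \<inter> dom L"
  by (auto simp: op_diff_def split: if_splits)

lemma op_diff_app [simp]: "x \<in> dom K \<Longrightarrow> x \<in> dom L \<Longrightarrow> (K -\<^sub>o\<^sub>p L) \<cdot> x = K \<cdot> x - L \<cdot> x"
  by (simp add: op_diff_def)

lemma dom_map_comp: "dom (K \<circ>\<^sub>m L) = {x \<in> dom L. L \<cdot> x \<in> dom K}"
  by (auto simp: map_comp_def dom_def split: option.splits)

lemma map_comp_app: "x \<in> dom L \<Longrightarrow> (K \<circ>\<^sub>m L) \<cdot> x = K \<cdot> (L \<cdot> x)"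
  by (auto simp: map_comp_def)

text \<open>\<open>op_zero\<close> is defined everywhere, so zero entries impose no domain
  condition.\<close>

lemma dom_op_block_diag [simp]:
  "dom (op_block P op_zero op_zero S) = dom (P :: 'a \<rightharpoonup> 'c::monoid_add)
    \<times> dom (S :: 'b \<rightharpoonup> 'd::monoid_add)"
  by (auto simp: op_block_def op_zero_def split: if_splits)

lemma op_block_diag_app [simp]:
  "z \<in> dom P \<times> dom S \<Longrightarrow>
    op_block P op_zero op_zero S \<cdot> z = (P \<cdot> fst z :: 'c::monoid_add, S \<cdot> snd z :: 'd::monoid_add)"
  by (auto simp: op_block_def op_zero_def)

lemma dom_op_block_offdiag [simp]:
  "dom (op_block op_zero Q R op_zero) = dom (R :: 'a \<rightharpoonup> 'd::monoid_add)
    \<times> dom (Q :: 'b \<rightharpoonup> 'c::monoid_add)"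
  by (auto simp: op_block_def op_zero_def split: if_splits)

lemma op_block_offdiag_app [simp]:
  "z \<in> dom R \<times> dom Q \<Longrightarrow>
    op_block op_zero Q R op_zero \<cdot> z = (Q \<cdot> snd z :: 'c::monoid_add, R \<cdot> fst z :: 'd::monoid_add)"
  by (auto simp: op_block_def op_zero_def)

section \<open>Graph subspaces and their orthogonal complements\<close>

lemma op_graph_total: "dom K = UNIV \<Longrightarrow> op_graph K = {z. snd z = K \<cdot> fst z}"
  by (auto simp: op_graph_def)

lemma closed_op_graph:
  assumes "bounded_op K"
  shows "closed (op_graph K)"
proof -
  have "continuous_on UNIV (\<lambda>z::'a \<times> 'b. K \<cdot> fst z)"
    by (intro linear_continuous_on bounded_linear_compose[OF bounded_op_bounded_linear[OF assms]]
        bounded_linear_fst)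
  then have "closed {z::'a \<times> 'b. snd z = K \<cdot> fst z}"
    by (intro closed_Collect_eq continuous_on_snd continuous_on_id)
  then show ?thesis
    using assms by (simp add: op_graph_total bounded_op_def)
qed

lemma subspace_op_graph:
  assumes "bounded_op K"
  shows "complex_vector.subspace (op_graph K)"
  using assms linear_op_zero[of K]
  by (simp add: op_graph_total bounded_op_def complex_vector.subspace_def linear_op_def
      scaleC_prod_def)

text \<open>Moving \<open>K\<close> across, the inner product of the graph vector over
  \<open>f\<close> with \<open>z\<close> becomes that of \<open>f\<close> with
  \<open>fst z + K\<^sup>\<star> \<cdot> snd z\<close>; taking \<open>f\<close> to be that sum
  forces it to vanish.\<close>

lemma orth_compl_op_graph:
  fixes K :: "'a::complex_hilbert \<rightharpoonup> 'b::complex_inner"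
  assumes "bounded_op K"
  shows "orth_compl (op_graph K) = {z. fst z = - (K\<^sup>\<star> \<cdot> snd z)}"
proof -
  have K: "dom K = UNIV" using assms by (simp add: bounded_op_def)
  have adj: "cinner (K \<cdot> f) g = cinner f (K\<^sup>\<star> \<cdot> g)" for f g
    using op_adjoint_cinner[OF bounded_op_densely_defined[OF assms], of g f]
      dom_bounded_op_adjoint[OF assms] K by (metis UNIV_I cinner_commute)
  have "z \<in> orth_compl (op_graph K) \<longleftrightarrow> (\<forall>f. cinner f (fst z + K\<^sup>\<star> \<cdot> snd z) = 0)" for z
    by (auto simp: orth_compl_def op_graph_def K cinner_prod_def adj cinner_add_right)
  also have "\<dots> z \<longleftrightarrow> fst z = - (K\<^sup>\<star> \<cdot> snd z)" for z
    by (metis add.right_inverse add_eq_0_iff2 cinner_eq_zero_iff cinner_zero_right)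
  finally show ?thesis by blast
qed

text \<open>A difference \<open>d\<close> of two points with the same image satisfies
  \<open>d = - y d\<close>. Skewness makes \<open>cinner d (y d)\<close> purely imaginary, so the
  squared norm of \<open>d\<close> is zero.\<close>

lemma inj_perturbation_of_skew:
  fixes y :: "'a::complex_inner \<Rightarrow> 'a"
  assumes diff: "\<And>u v. y (u - v) = y u - y v"
    and skew: "\<And>u v. cinner u (y v) = - cinner (y u) v"
  shows "inj (\<lambda>u. u + y u)"
proof (rule injI)
  fix u v assume eq: "u + y u = v + y v"
  define d where "d = u - v"
  have d: "d = - y d" using eq by (simp add: d_def diff algebra_simps)
  have "Re (cinner d (y d)) = - Re (cinner d (y d))"
    using skew[of d d] cinner_commute[of "y d" d] by (simp add: complex_eq_iff)
  then have "Re (cinner d d) = 0"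
    by (subst (2) d) (simp add: cinner_minus_right)
  then have "d = 0" by (simp add: cinner_self)
  then show "u = v" by (simp add: d_def)
qed

section \<open>Block diagonalization\<close>

theorem theorem2p10:
  fixes A0 :: "'a::complex_hilbert \<rightharpoonup> 'a"
    and A1 :: "'b::complex_hilbert \<rightharpoonup> 'b"
    and W :: "'b \<rightharpoonup> 'a"
    and X :: "'a \<rightharpoonup> 'b"
    and A V Y T :: "'a \<times> 'b \<rightharpoonup> 'a \<times> 'b"
  assumes A: "A = op_block A0 op_zero op_zero A1"
    and A_sa: "self_adjoint A"
    and W_lin: "linear_op W"
    and W_dense: "densely_defined W"
    and dom_W: "dom A1 \<subseteq> dom W"
    and dom_W_adj: "dom A0 \<subseteq> dom (W\<^sup>\<star>)"
    and V: "V = op_block op_zero W (W\<^sup>\<star>) op_zero"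
    and X: "bounded_op X"
    and Y: "Y = op_block op_zero (op_uminus (X\<^sup>\<star>)) X op_zero"
    and T: "T = op_id +\<^sub>o\<^sub>p Y"
  shows "(T\<^sup>\<star> \<circ>\<^sub>m (A +\<^sub>o\<^sub>p V) \<circ>\<^sub>m op_inverse (T\<^sup>\<star>) = (A -\<^sub>o\<^sub>p (Y \<circ>\<^sub>m V)) \<and>
           (A -\<^sub>o\<^sub>p (Y \<circ>\<^sub>m V)) =
             op_block (A0 +\<^sub>o\<^sub>p (X\<^sup>\<star> \<circ>\<^sub>m W\<^sup>\<star>)) op_zero op_zero (A1 -\<^sub>o\<^sub>p (X \<circ>\<^sub>m W))
         \<longleftrightarrow> reducing_subspace (op_graph X) (A +\<^sub>o\<^sub>p V) \<and> strong_riccati_solution A V Y)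
       \<and> (reducing_subspace (op_graph X) (A +\<^sub>o\<^sub>p V) \<and> strong_riccati_solution A V Y \<longrightarrow>
           op_inverse T \<circ>\<^sub>m (A +\<^sub>o\<^sub>p V) \<circ>\<^sub>m T = (A +\<^sub>o\<^sub>p (V \<circ>\<^sub>m Y)) \<and>
           (A +\<^sub>o\<^sub>p (V \<circ>\<^sub>m Y)) =
             op_block (A0 +\<^sub>o\<^sub>p (W \<circ>\<^sub>m X)) op_zero op_zero (A1 -\<^sub>o\<^sub>p (W\<^sup>\<star> \<circ>\<^sub>m X\<^sup>\<star>)))"
proof -

  \<comment> \<open>The bounded operators \<open>X\<close>, \<open>Y\<close>, \<open>T\<close> and
    their adjoints as total functions\<close>
  define xx where "xx f = X \<cdot> f" for f
  define xs where "xs g = X\<^sup>\<star> \<cdot> g" for g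
  define y where "y z = (- xs (snd z), xx (fst z))" for z
  have X_eq: "X = (\<lambda>f. Some (xx f))"
    unfolding xx_def by (rule ext) (rule bounded_op_total[OF X])
  have dom_X: "dom X = UNIV" by (simp add: X_eq dom_def)
  have dom_XS: "dom (X\<^sup>\<star>) = UNIV" by (rule dom_bounded_op_adjoint[OF X])
  have XS_lin: "linear_op (X\<^sup>\<star>)"
    by (rule linear_op_adjoint[OF bounded_op_densely_defined[OF X]])
  have X_lin: "linear_op X" using X by (simp add: bounded_op_def)
  have WS_lin: "linear_op (W\<^sup>\<star>)" by (rule linear_op_adjoint[OF W_dense])
  have A_lin: "linear_op A" using A_sa by (simp add: self_adjoint_def)
  have xx: "xx (f + g) = xx f + xx g" "xx (f - g) = xx f - xx g"
    "xx (- f) = - xx f" "xx 0 = 0" for f g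
    using linear_op_add(2)[OF X_lin] linear_op_diff(2)[OF X_lin] linear_op_minus(2)[OF X_lin]
      linear_op_zero[OF X_lin] by (auto simp: xx_def dom_X)
  have xs: "xs (f + g) = xs f + xs g" "xs (f - g) = xs f - xs g"
    "xs (- f) = - xs f" "xs 0 = 0" for f g
    using linear_op_add(2)[OF XS_lin] linear_op_diff(2)[OF XS_lin] linear_op_minus(2)[OF XS_lin]
      linear_op_zero[OF XS_lin] by (auto simp: xs_def dom_XS)
  have adj: "cinner g (xx f) = cinner (xs g) f" for f g
    unfolding xx_def xs_def
    by (rule op_adjoint_cinner[OF bounded_op_densely_defined[OF X]]) (simp_all add: dom_X dom_XS)
  then have adj': "cinner (xx f) g = cinner f (xs g)" for f g
    by (metis cinner_commute)
  have y_lin: "y (u + v) = y u + y v" "y (u - v) = y u - y v" "y (- u) = - y u" for u v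
    by (simp_all add: y_def xx xs prod_eq_iff)
  have skew: "cinner u (y v) = - cinner (y u) v" for u v
    by (simp add: y_def cinner_prod_def cinner_minus_left cinner_minus_right adj adj')

  have dom_Y: "dom Y = UNIV" and Y_app: "Y \<cdot> z = y z" for z
  proof -
    have dom_neg: "dom (op_uminus (X\<^sup>\<star>)) = UNIV"
      using dom_XS by (auto simp: op_uminus_def dom_def)
    have neg: "op_uminus (X\<^sup>\<star>) \<cdot> g = - xs g" for g
      using dom_XS by (auto simp: op_uminus_def xs_def dom_def option.map_sel set_eq_iff)
    show "dom Y = UNIV" by (simp add: Y dom_neg dom_X)
    show "Y \<cdot> z = y z" by (simp add: Y dom_neg dom_X y_def neg xx_def)
  qed
  \<comment> \<open>\<open>S\<close> and \<open>S'\<close> are the total functions behind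
    \<open>T\<^sup>\<star>\<close> and \<open>T\<close>; skewness of \<open>y\<close> identifies
    \<open>S\<close> with the adjoint below.\<close>
  define S where "S u = u - y u" for u
  define S' where "S' u = u + y u" for u
  have S_comp: "fst (S u) = fst u + xs (snd u)" "snd (S u) = snd u - xx (fst u)" for u
    by (simp_all add: S_def y_def)
  have S_add: "S (u + v) = S u + S v" for u v by (simp add: S_def y_lin)
  have inj_S: "inj S"
    using inj_perturbation_of_skew[of "\<lambda>u. - y u"] unfolding S_def
    by (simp add: y_lin cinner_minus_left cinner_minus_right skew)
  have inj_S': "inj S'"
    unfolding S'_def by (rule inj_perturbation_of_skew[OF y_lin(2) skew])
  have T_app: "T \<cdot> u = S' u" and dom_T: "dom T = UNIV" for u
  proof -
    have [simp]: "dom op_id = UNIV" "op_id \<cdot> u = u" for u :: "'a \<times> 'b"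
      by (auto simp: op_id_def)
    show "T \<cdot> u = S' u" "dom T = UNIV" by (simp_all add: T dom_Y Y_app S'_def)
  qed
  have T_eq: "T = (\<lambda>u. Some (S' u))"
    by (rule op_eqI) (auto simp: dom_T T_app)
  have TS_eq: "T\<^sup>\<star> = (\<lambda>u. Some (S u))"
  proof
    fix u show "(T\<^sup>\<star>) u = Some (S u)"
      by (rule op_adjoint_eqI)
        (simp_all add: densely_defined_def dom_T T_app S_def S'_def cinner_add_right
          cinner_diff_left skew)
  qed

  \<comment> \<open>Domains and values of the unbounded operators\<close>
  have dom_A: "dom A = dom A0 \<times> dom A1" by (simp add: A)
  have A_app: "A \<cdot> z = (A0 \<cdot> fst z, A1 \<cdot> snd z)" if "z \<in> dom A" for z
    using that by (simp add: A)
  have dom_V: "dom V = dom (W\<^sup>\<star>) \<times> dom W" by (simp add: V)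
  have V_app: "V \<cdot> z = (W \<cdot> snd z, W\<^sup>\<star> \<cdot> fst z)" if "z \<in> dom V" for z
    using that by (simp add: V)
  have A_V: "dom A \<subseteq> dom V" using dom_W dom_W_adj by (auto simp: dom_A dom_V)
  \<comment> \<open>Linearity is assumed for \<open>A\<close>, not for its entries; their behaviour
    at 0 is read off from \<open>A\<close> at the zero vector.\<close>
  have A_zero: "A0 \<cdot> 0 = 0" "A1 \<cdot> 0 = 0" "0 \<in> dom A0" "0 \<in> dom A1"
    using A_app[OF linear_op_zero_dom[OF A_lin]] linear_op_zero[OF A_lin]
      linear_op_zero_dom[OF A_lin] by (auto simp: dom_A zero_prod_def)
  have V_lin: "V \<cdot> (u + v) = V \<cdot> u + V \<cdot> v" "V \<cdot> (u - v) = V \<cdot> u - V \<cdot> v"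
    if "u \<in> dom V" "v \<in> dom V" for u v
    using that linear_op_add[OF WS_lin] linear_op_add[OF W_lin]
      linear_op_diff[OF WS_lin] linear_op_diff[OF W_lin]
    by (simp_all add: V_app dom_V mem_Times_iff)

  let ?AV = "A +\<^sub>o\<^sub>p V"
  let ?L = "A -\<^sub>o\<^sub>p (Y \<circ>\<^sub>m V)"
  let ?L' = "A +\<^sub>o\<^sub>p (V \<circ>\<^sub>m Y)"
  let ?G = "op_graph X"
  have dom_AV: "dom ?AV = dom A" using A_V by auto
  have AV_app: "?AV \<cdot> z = A \<cdot> z + V \<cdot> z" if "z \<in> dom A" for z
    using that A_V by (intro op_add_app) auto
  have dom_YV: "dom (Y \<circ>\<^sub>m V) = dom V" by (simp add: dom_map_comp dom_Y)
  have dom_L: "dom ?L = dom A" using A_V by (auto simp: dom_YV)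
  have L_app: "?L \<cdot> z = A \<cdot> z - y (V \<cdot> z)" if "z \<in> dom A" for z
    using that by (simp add: dom_YV map_comp_app Y_app subsetD[OF A_V])
  have dom_VY: "dom (V \<circ>\<^sub>m Y) = {z. y z \<in> dom V}" by (simp add: dom_map_comp dom_Y Y_app)
  have L'_app: "?L' \<cdot> z = A \<cdot> z + V \<cdot> (y z)" if "z \<in> dom A" "y z \<in> dom V" for z
    using that by (simp add: dom_VY map_comp_app dom_Y Y_app)

  \<comment> \<open>A product of two off-diagonal matrices is diagonal, so both block formulas hold
    without invoking reduction or the Riccati equation.\<close>
  have block: "?L = op_block (A0 +\<^sub>o\<^sub>p (X\<^sup>\<star> \<circ>\<^sub>m W\<^sup>\<star>)) op_zero op_zero (A1 -\<^sub>o\<^sub>p (X \<circ>\<^sub>m W))"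
    (is "_ = ?B")
  proof (rule op_eqI)
    show dom_B: "dom ?L = dom ?B"
      using dom_W dom_W_adj unfolding dom_L by (auto simp: dom_A dom_map_comp dom_X dom_XS)
    fix z assume z: "z \<in> dom ?B"
    then have "z \<in> dom A" using dom_B dom_L by blast
    with z show "?L \<cdot> z = ?B \<cdot> z"
      by (simp add: L_app A_app V_app subsetD[OF A_V] mem_Times_iff y_def map_comp_app
          dom_map_comp dom_X dom_XS
          xx_def xs_def)
  qed
  \<comment> \<open>Here the domains depend on \<open>X\<close>; the sign in the upper entry of
    \<open>Y\<close> is removed by linearity of \<open>W\<^sup>\<star>\<close>.\<close>
  have block': "?L' = op_block (A0 +\<^sub>o\<^sub>p (W \<circ>\<^sub>m X)) op_zero op_zero
      (A1 -\<^sub>o\<^sub>p (W\<^sup>\<star> \<circ>\<^sub>m X\<^sup>\<star>))" (is "_ = ?B")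
  proof (rule op_eqI)
    show dom_B: "dom ?L' = dom ?B"
      unfolding dom_op_block_diag dom_op_add dom_op_diff dom_VY dom_V dom_A set_eq_iff mem_Times_iff
        Int_iff mem_Collect_eq dom_map_comp[of W] dom_map_comp[of "W\<^sup>\<star>"] dom_X dom_XS
      by (simp add: y_def xx_def xs_def linear_op_minus_dom_iff[OF WS_lin]) blast
    fix z assume z: "z \<in> dom ?B"
    then have "z \<in> dom A" "y z \<in> dom V" using dom_B dom_VY by auto
    with z show "?L' \<cdot> z = ?B \<cdot> z"
      by (simp add: L'_app A_app V_app mem_Times_iff y_def map_comp_app
          dom_map_comp dom_X dom_XS xx_def xs_def
          linear_op_minus[OF WS_lin])
  qed

  have G: "u \<in> ?G \<longleftrightarrow> snd (S u) = 0" for u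
    by (simp add: op_graph_total dom_X S_comp xx_def)
  have G_orth: "u \<in> orth_compl ?G \<longleftrightarrow> fst (S u) = 0" for u
    by (simp add: orth_compl_op_graph[OF X] S_comp xs_def eq_neg_iff_add_eq_0)

  \<comment> \<open>Expanding both sides of the intertwining relation, the terms
    \<open>A \<cdot> u\<close> and \<open>y (V \<cdot> u)\<close> cancel and the Riccati expression
    remains.\<close>
  have riccati_iff: "A \<cdot> (y u) - y (A \<cdot> u) - y (V \<cdot> (y u)) + V \<cdot> u = 0 \<longleftrightarrow>
      ?L \<cdot> (S u) = S (?AV \<cdot> u)" if u: "u \<in> dom A" "y u \<in> dom A" for u
  proof -
    have "S u \<in> dom A" unfolding S_def by (rule linear_op_diff(1)[OF A_lin u])
    then have "S (?AV \<cdot> u) - ?L \<cdot> (S u) = A \<cdot> (y u) - y (A \<cdot> u) - y (V \<cdot> (y u)) + V \<cdot> u"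
      using u
      by (simp add: AV_app L_app S_def linear_op_diff(2)[OF A_lin] V_lin subsetD[OF A_V] y_lin
          algebra_simps)
    then show ?thesis by (metis eq_iff_diff_eq_0)
  qed

  have similar_iff: "T\<^sup>\<star> \<circ>\<^sub>m ?AV \<circ>\<^sub>m op_inverse (T\<^sup>\<star>) = ?L \<longleftrightarrow>
    dom A \<subseteq> range S \<and> (\<forall>u. S u \<in> dom A \<longleftrightarrow> u \<in> dom A) \<and>
      (\<forall>u\<in>dom A. ?L \<cdot> (S u) = S (?AV \<cdot> u))"
  proof -
    have "?L (S u) = map_option S (?AV u) \<longleftrightarrow>
        (S u \<in> dom A \<longleftrightarrow> u \<in> dom A) \<and> (u \<in> dom A \<longrightarrow> ?L \<cdot> (S u) = S (?AV \<cdot> u))" for u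
      unfolding eq_map_option_iff dom_L dom_AV by (rule refl)
    then show ?thesis
      unfolding TS_eq similar_eq_iff[OF inj_S] dom_L by blast
  qed

  \<comment> \<open>From diagonalization to reduction and the Riccati equation\<close>
  have forward: "reducing_subspace ?G ?AV \<and> strong_riccati_solution A V Y"
    if "T\<^sup>\<star> \<circ>\<^sub>m ?AV \<circ>\<^sub>m op_inverse (T\<^sup>\<star>) = ?L"
  proof
    from that have ran: "dom A \<subseteq> range S" and S_dom: "\<And>u. S u \<in> dom A \<longleftrightarrow> u \<in> dom A"
      and inter: "\<And>u. u \<in> dom A \<Longrightarrow> ?L \<cdot> (S u) = S (?AV \<cdot> u)"
      unfolding similar_iff by blast+
    \<comment> \<open>Because \<open>y u = u - S u\<close>, invariance of \<open>dom A\<close> under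
      \<open>S\<close> is invariance under \<open>y\<close>.\<close>
    have y_dom: "y u \<in> dom A" if "u \<in> dom A" for u
      using linear_op_diff(1)[OF A_lin that, of "S u"] that S_dom by (simp add: S_def)
    show "strong_riccati_solution A V Y"
      unfolding strong_riccati_solution_def Y_app using y_dom riccati_iff inter by blast
    have L_comp: "fst (?L \<cdot> z) = A0 \<cdot> fst z + xs (W\<^sup>\<star> \<cdot> fst z)"
      "snd (?L \<cdot> z) = A1 \<cdot> snd z - xx (W \<cdot> snd z)" if "z \<in> dom A" for z
      using that by (simp_all add: L_app A_app V_app subsetD[OF A_V] y_def)
    \<comment> \<open>Membership in the graph says that the second component of \<open>S u\<close>
      is 0. Each component of \<open>?L\<close> depends only on the matching component of its
      argument, and the intertwining relation carries the zero over to
      \<open>S (?AV \<cdot> u)\<close>.\<close>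
    have "invariant_subspace ?G ?AV"
      unfolding invariant_subspace_def dom_AV
      using closed_op_graph[OF X] subspace_op_graph[OF X]
      by (auto simp: G L_comp S_dom A_zero linear_op_zero[OF W_lin] xx simp flip: inter)
    moreover have "invariant_subspace (orth_compl ?G) ?AV"
      unfolding invariant_subspace_def dom_AV
      by (auto simp: closed_orth_compl subspace_orth_compl G_orth L_comp S_dom A_zero
          linear_op_zero[OF WS_lin] xs simp flip: inter)
    moreover have "dom ?AV = {u + v | u v. u \<in> dom ?AV \<inter> ?G \<and> v \<in> dom ?AV \<inter> orth_compl ?G}"
      unfolding dom_AV
    proof (intro equalityI subsetI)
      \<comment> \<open>Split \<open>S z\<close> along the two summands, which keeps it in the
        product domain, and pull both parts back through \<open>S\<close>; injectivity recombines
        the preimages to \<open>z\<close>.\<close>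
      fix z assume "z \<in> dom A"
      then have "(fst (S z), 0) \<in> dom A" "(0, snd (S z)) \<in> dom A"
        using S_dom[of z] A_zero by (auto simp: dom_A mem_Times_iff)
      moreover have "\<exists>u\<in>dom A. S u = w" if w: "w \<in> dom A" for w
      proof -
        from w ran obtain u where "w = S u" by blast
        then show ?thesis using w S_dom[of u] by auto
      qed
      ultimately obtain u v where uv: "S u = (fst (S z), 0)" "S v = (0, snd (S z))"
        "u \<in> dom A" "v \<in> dom A"
        by metis
      have "S (u + v) = S z" by (simp add: S_add uv)
      then have "z = u + v" using inj_S by (auto dest: injD)
      moreover have "u \<in> ?G" "v \<in> orth_compl ?G" by (simp_all add: G G_orth uv)
      ultimately show "z \<in> {u + v | u v. u \<in> dom A \<inter> ?G \<and> v \<in> dom A \<inter> orth_compl ?G}"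
        using uv by blast
    qed (use linear_op_add(1)[OF A_lin] in blast)
    ultimately show "reducing_subspace ?G ?AV" unfolding reducing_subspace_def by blast
  qed

  \<comment> \<open>From reduction and the Riccati equation to both diagonalizations\<close>
  have backward: "T\<^sup>\<star> \<circ>\<^sub>m ?AV \<circ>\<^sub>m op_inverse (T\<^sup>\<star>) = ?L \<and> op_inverse T \<circ>\<^sub>m ?AV \<circ>\<^sub>m T = ?L'"
    if red: "reducing_subspace ?G ?AV" and ric: "strong_riccati_solution A V Y"
  proof
    have y_dom: "y u \<in> dom A" and inter: "?L \<cdot> (S u) = S (?AV \<cdot> u)"
      and ric_eq: "A \<cdot> (y u) - y (A \<cdot> u) - y (V \<cdot> (y u)) + V \<cdot> u = 0" if "u \<in> dom A" for u
      using ric that riccati_iff unfolding strong_riccati_solution_def Y_app by blast+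
    have S_dom: "S u \<in> dom A" and S'_dom: "S' u \<in> dom A" if "u \<in> dom A" for u
      unfolding S_def S'_def
      using linear_op_diff(1)[OF A_lin that] linear_op_add(1)[OF A_lin that] y_dom[OF that] by auto
    have split: "\<exists>u v. z = u + v \<and> u \<in> dom A \<and> snd u = xx (fst u)
        \<and> v \<in> dom A \<and> fst v = - xs (snd v)" if "z \<in> dom A" for z
    proof -
      from that red obtain u v where "z = u + v" "u \<in> dom A \<inter> ?G" "v \<in> dom A \<inter> orth_compl ?G"
        unfolding reducing_subspace_def dom_AV by blast
      then show ?thesis
        unfolding orth_compl_op_graph[OF X] unfolding op_graph_total[OF dom_X] xx_def xs_def by blast
    qed
    have preimage: "\<exists>u\<in>dom A. S u = z" if z: "z \<in> dom A" for z
    proof -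
      have "(fst z, 0) \<in> dom A" "(0, snd z) \<in> dom A"
        using z A_zero by (auto simp: dom_A)
      \<comment> \<open>The graph part \<open>p\<close> of the first vector satisfies
        \<open>S p = (fst z, 0)\<close>: its second component vanishes on the graph, and
        \<open>snd p = - snd q\<close> turns \<open>xs (snd p)\<close> into \<open>fst q\<close>.
        Symmetrically \<open>S q' = (0, snd z)\<close>, so \<open>p + q'\<close> is the
        preimage.\<close>
      then obtain p q p' q' where p: "(fst z, 0) = p + q" "p \<in> dom A" "snd p = xx (fst p)"
          "fst q = - xs (snd q)"
        and q: "(0, snd z) = p' + q'" "q' \<in> dom A" "snd p' = xx (fst p')" "fst q' = - xs (snd q')"
        using split by metis
      have "fst z = fst p + fst q" "snd p = - snd q" "fst p' = - fst q'" "snd z = snd p' + snd q'"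
        using p(1) q(1) by (auto simp: prod_eq_iff eq_neg_iff_add_eq_0)
      then have "S (p + q') = z"
        using p q by (simp add: S_add prod_eq_iff S_comp xs xx)
      then show ?thesis using linear_op_add(1)[OF A_lin p(2) q(2)] by blast
    qed
    show "T\<^sup>\<star> \<circ>\<^sub>m ?AV \<circ>\<^sub>m op_inverse (T\<^sup>\<star>) = ?L"
      unfolding similar_iff
    proof (intro conjI allI ballI iffI subsetI)
      show "z \<in> range S" if "z \<in> dom A" for z
        using preimage[OF that] by blast
      show "u \<in> dom A" if "S u \<in> dom A" for u
        using preimage[OF that] injD[OF inj_S] by blast
    qed (fact S_dom inter)+
    \<comment> \<open>\<open>S'\<close> sends \<open>(f, 0)\<close> into the graph and
      \<open>(0, g)\<close> into its complement. The splitting of \<open>S' u\<close> therefore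
      displays \<open>u\<close> as \<open>(fst p, snd q)\<close>, and both coordinates lie in the
      factors of \<open>dom A\<close>.\<close>
    have S'_dom_iff: "S' u \<in> dom A \<longleftrightarrow> u \<in> dom A" for u
    proof
      assume "S' u \<in> dom A"
      with split obtain p q where pq: "S' u = p + q" "p \<in> dom A" "snd p = xx (fst p)"
        "q \<in> dom A" "fst q = - xs (snd q)" by metis
      then have "S' (fst p, snd q) = S' u"
        by (simp add: pq(1) prod_eq_iff) (simp add: S'_def y_def)
      then have "u = (fst p, snd q)" using inj_S' by (metis injD)
      then show "u \<in> dom A" using pq by (auto simp: dom_A mem_Times_iff)
    qed (rule S'_dom)
    \<comment> \<open>The Riccati solution property keeps \<open>y u\<close> in
      \<open>dom A\<close>, hence in \<open>dom V\<close>, so the natural domain of the product cuts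
      nothing off.\<close>
    have dom_L': "dom ?L' = dom A" unfolding dom_op_add dom_VY using y_dom A_V by blast
    \<comment> \<open>The same Riccati expression appears; this time \<open>A \<cdot> u\<close> and
      \<open>V \<cdot> (y u)\<close> cancel.\<close>
    have inter': "?AV \<cdot> (S' u) = S' (?L' \<cdot> u)" if u: "u \<in> dom A" for u
    proof -
      have "?AV \<cdot> (S' u) - S' (?L' \<cdot> u) = A \<cdot> (y u) - y (A \<cdot> u) - y (V \<cdot> (y u)) + V \<cdot> u"
        using u y_dom[OF u] S'_dom[OF u]
        by (simp add: AV_app L'_app S'_def linear_op_add(2)[OF A_lin] V_lin subsetD[OF A_V] y_lin
            algebra_simps)
      then show ?thesis using ric_eq[OF u] by simp
    qed
    have "?AV (S' u) = map_option S' (?L' u)" for u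
      unfolding eq_map_option_iff dom_L' dom_AV using S'_dom_iff inter' by blast
    then show "op_inverse T \<circ>\<^sub>m ?AV \<circ>\<^sub>m T = ?L'"
      unfolding T_eq by (rule similar_eqI[OF inj_S'])
  qed

  show ?thesis
    using forward backward block block' by blast
qed

end
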